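(* Assume that for some $\Delta$ one has $1\le d_i^{(n)}\le\Delta$ for all $i,n$, and let $G_n$ be the simple graph obtained from the configuration model with degree sequence $(d_i^{(n)})_{i=1}^n$, that is, the pairing model conditioned on simplicity. Then for every $\varepsilon>0$ there exists $\eta=\eta(\Delta,\varepsilon)>0$ such that $$\mathbb P\Bigl(\forall S\subset[n]\text{ with }|S|\le\eta n:\ e_{G_n}(S)\le(1+\varepsilon)|S|\Bigr)\xrightarrow[n\to\infty]{}1.$$
   Context: $[n]=\{1,\dots,n\}$. For each $n$, $(d_i^{(n)})_{i=1}^n$ is a deterministic sequence of integers with even sum. Pairing (configuration) model: attach $d_i^{(n)}$ half-edges to vertex $i$ and choose a uniformly random pairing of all half-edges; each pair becomes an edge, giving a random multigraph $\widetilde G_n$ on $[n]$, possibly with self-loops and multiple edges. The simple graph $G_n$ has the law of $\widetilde G_n$ conditioned on the event that $\widetilde G_n$ is simple. $e_G(S)$ is the number of edges of $G$ with both endpoints in $S$. *)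

theory Defs
  imports "HOL-Probability.Probability" "HOL-Library.Multiset" "HOL-Library.Disjoint_Sets"
begin

definition half_edges :: "nat \<Rightarrow> (nat \<Rightarrow> nat) \<Rightarrow> (nat \<times> nat) set" where
  "half_edges n d = (SIGMA i:{1..n}. {..<d i})"

definition pairings :: "'a set \<Rightarrow> 'a set set set" where
  "pairings H = {M. partition_on H M \<and> (\<forall>e\<in>M. card e = 2)}"

text \<open>A multigraph is the multiset of its edges. The edge between \<open>u\<close> and \<open>v\<close> is the set
  \<open>{u, v}\<close>, so a self-loop at \<open>v\<close> is the singleton \<open>{v}\<close>. The vertex set is not recorded:
  it is always \<open>{1..n}\<close>.\<close>

type_synonym multigraph = "nat set multiset"

definition multigraph_of_pairing :: "(nat \<times> nat) set set \<Rightarrow> multigraph" where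
  "multigraph_of_pairing M = image_mset (\<lambda>e. fst ` e) (mset_set M)"

definition simple :: "multigraph \<Rightarrow> bool" where
  "simple G \<longleftrightarrow> (\<forall>e\<in>#G. card e = 2 \<and> count G e = 1)"

definition edges_within :: "multigraph \<Rightarrow> nat set \<Rightarrow> nat" where
  "edges_within G S = size {#e \<in># G. e \<subseteq> S#}"

text \<open>This is the intended law only if the sum of the degrees is even; otherwise there is no
  pairing and the value is unspecified (see \<open>pairings_half_edges_nonempty\<close>).\<close>

definition pairing_model :: "nat \<Rightarrow> (nat \<Rightarrow> nat) \<Rightarrow> multigraph pmf" where
  "pairing_model n d =
     map_pmf multigraph_of_pairing (pmf_of_set (pairings (half_edges n d)))"

text \<open>The conditional law is unspecified if the multigraph is almost surely not simple. For
  bounded positive degrees this can happen for finitely many \<open>n\<close> only, so it does not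
  affect limits as \<open>n\<close> tends to infinity.\<close>

definition simple_configuration_model :: "nat \<Rightarrow> (nat \<Rightarrow> nat) \<Rightarrow> multigraph pmf" where
  "simple_configuration_model n d = cond_pmf (pairing_model n d) {G. simple G}"

lemma finite_half_edges: "finite (half_edges n d)"
  by (simp add: half_edges_def)

lemma card_half_edges: "card (half_edges n d) = (\<Sum>i=1..n. d i)"
  by (simp add: half_edges_def)

lemma finite_pairings:
  assumes "finite H"
  shows "finite (pairings H)"
proof (rule finite_subset)
  show "pairings H \<subseteq> Pow (Pow H)"
    by (auto simp: pairings_def partition_on_def)
qed (simp add: assms)

lemma pairings_nonempty:
  assumes "finite H" "even (card H)"
  shows "pairings H \<noteq> {}"
  using assms
proof (induction "card H" arbitrary: H rule: less_induct)
  case less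
  show ?case
  proof (cases "H = {}")
    case True
    then have "{} \<in> pairings H" by (simp add: pairings_def partition_on_def)
    then show ?thesis by blast
  next
    case False
    then have pos: "card H > 0" using less.prems by (simp add: card_gt_0_iff)
    with less.prems(2) have "2 \<le> card H" by presburger
    then obtain e where e: "e \<subseteq> H" "card e = 2" "finite e"
      by (rule obtain_subset_with_card_n)
    have c: "card (H - e) = card H - 2"
      using e by (simp add: card_Diff_subset)
    have "pairings (H - e) \<noteq> {}"
      by (rule less.hyps) (use c pos less.prems in auto)
    then obtain M where M: "partition_on (H - e) M" "\<forall>x\<in>M. card x = 2"
      by (auto simp: pairings_def)
    have "e \<noteq> {}" using e by auto
    then have "partition_on H (insert e M)"
      using M(1) e(1) by (auto simp: partition_on_def disjoint_def)
    then have "insert e M \<in> pairings H"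
      using M(2) e(2) by (simp add: pairings_def)
    then show ?thesis by blast
  qed
qed

lemma pairings_half_edges_nonempty:
  "even (\<Sum>i=1..n. d i) \<Longrightarrow> pairings (half_edges n d) \<noteq> {}"
  by (rule pairings_nonempty) (simp_all add: finite_half_edges card_half_edges)

end

theory Submission
  imports Defs "HOL-Real_Asymp.Real_Asymp"
begin

text \<open>
  Call a pairing simple if its multigraph is simple; \<open>G\<^sub>n\<close> comes from a uniformly random simple
  pairing. The proof is a first moment bound carried out inside the set of simple pairings.

  The key estimate is that a uniformly random simple pairing contains a given set \<open>A\<close> of \<open>k\<close>
  pairs with probability at most \<open>(O(1) / n)\<^sup>k\<close>, as long as \<open>k\<close> is a small multiple of \<open>n\<close>
  (\<open>card_simple_pairings_containing_le\<close>). It follows by adding the pairs of \<open>A\<close> one at a time and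
  comparing, for \<open>a = {x, y}\<close>, the simple pairings that contain \<open>insert a A\<close> with those that
  contain \<open>A\<close> (\<open>switching_count\<close>): in the former choose a pair \<open>{u, v}\<close> outside
  \<open>insert a A\<close> whose vertices are neither equal nor adjacent to the vertices of \<open>x\<close> and \<open>y\<close>, and
  switch \<open>{x, y}, {u, v}\<close> to \<open>{x, u}, {y, v}\<close>. The result is still simple. Bounded degrees leave
  a linear number of choices of \<open>{u, v}\<close>, and the switch can be undone because the result shows
  the new partners of \<open>x\<close> and \<open>y\<close>. The same switch, or a new pair of two unmatched
  half-edges if there are too few pairs for a switch, enlarges any partial simple pairing that
  leaves half-edges over; this gives the existence of a simple pairing for large \<open>n\<close>
  (\<open>simple_pairings_nonempty\<close>).

  A set \<open>S\<close> of \<open>s\<close> vertices with more than \<open>(1 + \<epsilon>) s\<close> inner edges contains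
  \<open>k = \<lceil>(1 + \<epsilon>) s\<rceil>\<close> pairs among the at most \<open>\<Delta> s\<close> half-edges at \<open>S\<close>. There are at most
  \<open>(3 n / s)\<^sup>s\<close> sets \<open>S\<close> and at most \<open>(3 \<Delta>\<^sup>2 s)\<^sup>k\<close> such sets of pairs, so that the expected
  number of bad choices with \<open>|S| = s\<close> is at most \<open>(C (s / n) powr \<epsilon>)\<^sup>s\<close> with \<open>C\<close> depending on
  \<open>\<Delta>\<close> and \<open>\<epsilon>\<close> only (\<open>union_bound_term_le\<close>). If \<open>\<eta>\<close> is so small that
  \<open>C \<eta> powr \<epsilon> \<le> 1/2\<close>, then all but one of the \<open>s\<close> factors can be bounded by \<open>1/2\<close>,
  and the sum over \<open>s\<close> is \<open>O(n powr -\<epsilon>)\<close>.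
\<close>

section \<open>Simple pairings and switchings\<close>

text \<open>A half-edge is a pair whose first component is the vertex that it is attached to, so
  \<open>(`) fst\<close> maps a pair of half-edges to the edge that it becomes. Sets \<open>H\<close> other than the set of
  all half-edges are allowed because switchings pass through partial pairings.\<close>

definition simple_pairings :: "('v \<times> 'b) set \<Rightarrow> ('v \<times> 'b) set set set" where
  "simple_pairings H =
     {M \<in> pairings H. (\<forall>e\<in>M. card (fst ` e) = 2) \<and> inj_on ((`) fst) M}"

text \<open>The closed neighbourhood of a vertex: a new pair with an end at \<open>v\<close> spoils simplicity
  exactly if its other end lies over this set.\<close>

definition nbhd :: "('v \<times> 'b) set set \<Rightarrow> 'v \<Rightarrow> 'v set" where
  "nbhd M v = insert v {w. {v, w} \<in> (`) fst ` M}"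

lemma simple_pairingsD:
  assumes "M \<in> simple_pairings H"
  shows "M \<in> pairings H" "disjoint M" "\<Union>M = H" "\<And>e. e \<in> M \<Longrightarrow> card e = 2"
    "\<And>e. e \<in> M \<Longrightarrow> card (fst ` e) = 2"
  using assms by (simp_all add: simple_pairings_def pairings_def partition_on_def)

lemma finite_simple_pairings: "finite H \<Longrightarrow> finite (simple_pairings H)"
  by (rule finite_subset[OF _ finite_pairings]) (auto simp: simple_pairings_def)

lemma simple_pairings_remove:
  assumes "M \<in> simple_pairings H" "e \<in> M"
  shows "M - {e} \<in> simple_pairings (H - e)"
proof -
  have "partition_on (H - e) (M - {e})"
  proof (rule partition_onI)
    have dis: "f \<inter> e = {}" if "f \<in> M - {e}" for f
      using that assms(2) simple_pairingsD(2)[OF assms(1)] by (auto dest: disjointD)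
    show "\<Union> (M - {e}) = H - e"
      using dis assms(2) simple_pairingsD(3)[OF assms(1)] by blast
    show "disjnt p q" if "p \<in> M - {e}" "q \<in> M - {e}" "p \<noteq> q" for p q
      using that simple_pairingsD(2)[OF assms(1)] by (auto simp: disjnt_def dest: disjointD)
    show "{} \<notin> M - {e}"
      using simple_pairingsD(4)[OF assms(1), of "{}"] by auto
  qed
  moreover have "inj_on ((`) fst) (M - {e})"
    using assms by (auto simp: simple_pairings_def intro: inj_on_diff)
  ultimately show ?thesis
    using assms(1) unfolding simple_pairings_def pairings_def by blast
qed

lemma simple_pairings_add:
  assumes M: "M \<in> simple_pairings H" and xy: "x \<notin> H" "y \<notin> H"
    and far: "fst y \<notin> nbhd M (fst x)"
  shows "insert {x, y} M \<in> simple_pairings (insert x (insert y H))"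
proof -
  have new: "x \<noteq> y" "fst x \<noteq> fst y" "{fst x, fst y} \<notin> (`) fst ` M"
    using far by (auto simp: nbhd_def)
  have "partition_on (insert x (insert y H)) (insert {x, y} M)"
    using M xy by (auto simp: simple_pairings_def pairings_def partition_on_def disjoint_def)
  moreover have "\<forall>e\<in>insert {x, y} M. card e = 2" "\<forall>e\<in>insert {x, y} M. card (fst ` e) = 2"
    using M new by (simp_all add: simple_pairings_def pairings_def)
  moreover have "inj_on ((`) fst) (insert {x, y} M)"
    using M new by (auto simp: simple_pairings_def inj_on_insert)
  ultimately show ?thesis
    by (simp add: simple_pairings_def pairings_def)
qed

text \<open>Removing \<open>{u, v}\<close> and then adding \<open>{x, u}\<close> and \<open>{y, v}\<close> keeps the pairing simple. The two new
  edges are not parallel to each other either: \<open>fst u\<close> and \<open>fst v\<close> are distinct, as \<open>M\<close> is simple,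
  and neither is \<open>fst x\<close> or \<open>fst y\<close>.\<close>

lemma simple_pairings_switch:
  assumes M: "M \<in> simple_pairings H" and xy: "x \<notin> H" "y \<notin> H" "x \<noteq> y"
    and uv: "{u, v} \<in> M" "u \<noteq> v"
    and far: "fst u \<notin> nbhd M (fst x) \<union> nbhd M (fst y)"
             "fst v \<notin> nbhd M (fst x) \<union> nbhd M (fst y)"
  shows "insert {x, u} (insert {y, v} (M - {{u, v}})) \<in> simple_pairings (insert x (insert y H))"
proof -
  have H: "u \<in> H" "v \<in> H"
    using M uv by (auto simp: simple_pairings_def pairings_def partition_on_def)
  have "fst u \<noteq> fst v"
    using M uv by (auto simp: simple_pairings_def)
  have 1: "M - {{u, v}} \<in> simple_pairings (H - {u, v})"
    using simple_pairings_remove[OF M uv(1)] .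
  have 2: "insert {x, u} (M - {{u, v}}) \<in> simple_pairings (insert x (insert u (H - {u, v})))"
    by (rule simple_pairings_add[OF 1]) (use xy far in \<open>auto simp: nbhd_def\<close>)
  have "insert {y, v} (insert {x, u} (M - {{u, v}}))
          \<in> simple_pairings (insert y (insert v (insert x (insert u (H - {u, v})))))"
    by (rule simple_pairings_add[OF 2])
       (use xy uv far H \<open>fst u \<noteq> fst v\<close> in \<open>auto simp: nbhd_def doubleton_eq_iff\<close>)
  moreover have "insert y (insert v (insert x (insert u (H - {u, v})))) = insert x (insert y H)"
    using H by auto
  ultimately show ?thesis
    by (simp add: insert_commute)
qed

lemma card_hitting_le:
  assumes "disjoint M" "finite B"
  shows "finite {e \<in> M. e \<inter> B \<noteq> {}}" "card {e \<in> M. e \<inter> B \<noteq> {}} \<le> card B"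
proof -
  define f where "f e = (SOME b. b \<in> e \<inter> B)" for e
  have f: "f e \<in> e \<inter> B" if "e \<inter> B \<noteq> {}" for e
    unfolding f_def using that some_in_eq[of "e \<inter> B"] by simp
  have inj: "inj_on f {e \<in> M. e \<inter> B \<noteq> {}}"
  proof (rule inj_onI)
    fix e e' assume e: "e \<in> {e \<in> M. e \<inter> B \<noteq> {}}" "e' \<in> {e \<in> M. e \<inter> B \<noteq> {}}" "f e = f e'"
    hence "f e \<in> e \<inter> e'" using f[of e] f[of e'] by simp
    thus "e = e'" using e assms(1) unfolding disjoint_def by blast
  qed
  have ran: "f ` {e \<in> M. e \<inter> B \<noteq> {}} \<subseteq> B"
    using f by auto
  show "finite {e \<in> M. e \<inter> B \<noteq> {}}" "card {e \<in> M. e \<inter> B \<noteq> {}} \<le> card B"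
    by (rule inj_on_finite[OF inj ran assms(2)], rule card_inj_on_le[OF inj ran assms(2)])
qed

text \<open>In the next lemmas \<open>H\<close> is the set of half-edges that \<open>M\<close> matches, and \<open>H'\<close> the set of all
  half-edges, in terms of which degrees are measured.\<close>

lemma card_nbhd_le:
  assumes M: "M \<in> simple_pairings H" and H: "H \<subseteq> H'" "finite H'"
    and deg: "card {h \<in> H'. fst h = v} \<le> D"
  shows "finite (nbhd M v)" "card (nbhd M v) \<le> 2 * D + 1"
proof -
  define E where "E = {e \<in> M. e \<inter> {h \<in> H'. fst h = v} \<noteq> {}}"
  note dis = simple_pairingsD(2)[OF M] and two = simple_pairingsD(5)[OF M]
  have sub: "e \<subseteq> H'" if "e \<in> M" for e
    using simple_pairingsD(3)[OF M] H(1) that by blast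
  have "finite {h \<in> H'. fst h = v}" using H(2) by simp
  note hit = card_hitting_le[OF dis this]
  have E: "finite E" "card E \<le> D"
    using hit(1) order_trans[OF hit(2) deg] by (simp_all only: E_def)
  have incl: "nbhd M v \<subseteq> insert v (\<Union>e\<in>E. fst ` e)"
  proof
    fix w assume "w \<in> nbhd M v"
    then consider "w = v" | e where "e \<in> M" "fst ` e = {v, w}" by (auto simp: nbhd_def)
    thus "w \<in> insert v (\<Union>e\<in>E. fst ` e)"
    proof cases
      case 2
      have "v \<in> fst ` e" "w \<in> fst ` e" unfolding 2(2) by simp_all
      then obtain h where "h \<in> e" "fst h = v" by blast
      hence "e \<in> E" using 2(1) sub unfolding E_def by blast
      thus ?thesis using \<open>w \<in> fst ` e\<close> by blast
    qed simp
  qed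
  have fin: "finite (\<Union>e\<in>E. fst ` e)"
    using E(1) two by (auto simp: E_def intro!: card_ge_0_finite)
  have "card (\<Union>e\<in>E. fst ` e) \<le> (\<Sum>e\<in>E. card (fst ` e))"
    by (rule card_UN_le[OF E(1)])
  also have "\<dots> = 2 * card E"
    using two by (simp add: E_def)
  finally have "card (\<Union>e\<in>E. fst ` e) \<le> 2 * D" using E(2) by linarith
  hence "card (insert v (\<Union>e\<in>E. fst ` e)) \<le> 2 * D + 1"
    using fin by (simp add: card_insert_if)
  moreover have fin': "finite (insert v (\<Union>e\<in>E. fst ` e))" using fin by simp
  ultimately show "finite (nbhd M v)" "card (nbhd M v) \<le> 2 * D + 1"
    using finite_subset[OF incl fin'] card_mono[OF fin' incl] by simp_all
qed

lemma card_half_edges_over_le: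
  assumes "finite H" "finite V" and deg: "\<And>v. card {h \<in> H. fst h = v} \<le> D"
  shows "card {h \<in> H. fst h \<in> V} \<le> D * card V"
proof -
  have "{h \<in> H. fst h \<in> V} = (\<Union>v\<in>V. {h \<in> H. fst h = v})" by auto
  also have "card \<dots> \<le> (\<Sum>v\<in>V. card {h \<in> H. fst h = v})"
    by (rule card_UN_le[OF assms(2)])
  also have "\<dots> \<le> (\<Sum>v\<in>V. D)" by (rule sum_mono) (rule deg)
  finally show ?thesis by (simp add: mult.commute)
qed

lemma card_over_nbhd_le:
  assumes M: "M \<in> simple_pairings H" and H: "H \<subseteq> H'" "finite H'"
    and deg: "\<And>v. card {h \<in> H'. fst h = v} \<le> D"
  shows "card {h \<in> H'. fst h \<in> nbhd M v} \<le> D * (2 * D + 1)"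
  using card_half_edges_over_le[OF H(2) card_nbhd_le(1)[OF M H deg] deg, of v]
    card_nbhd_le(2)[OF M H deg, of v]
  by (meson le_trans mult_le_mono2)

lemma card_over_two_nbhds_le:
  assumes M: "M \<in> simple_pairings H" and H: "H \<subseteq> H'" "finite H'"
    and deg: "\<And>v. card {h \<in> H'. fst h = v} \<le> D"
  shows "card {h \<in> H'. fst h \<in> nbhd M v \<union> nbhd M w} \<le> 2 * (D * (2 * D + 1))"
proof -
  have "{h \<in> H'. fst h \<in> nbhd M v \<union> nbhd M w} =
        {h \<in> H'. fst h \<in> nbhd M v} \<union> {h \<in> H'. fst h \<in> nbhd M w}" by auto
  thus ?thesis
    using card_over_nbhd_le[OF assms, of v] card_over_nbhd_le[OF assms, of w]
      card_Un_le[of "{h \<in> H'. fst h \<in> nbhd M v}" "{h \<in> H'. fst h \<in> nbhd M w}"]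
    by simp
qed

lemma card_pairing:
  assumes "M \<in> pairings H" "finite H"
  shows "finite M" "card H = 2 * card M"
proof -
  have M: "partition_on H M" "\<And>e. e \<in> M \<Longrightarrow> card e = 2"
    using assms by (auto simp: pairings_def)
  show fin: "finite M" using finite_elements[OF assms(2) M(1)] .
  have "card H = (\<Sum>e\<in>M. card e)"
    using card_Union_disjoint[of M] M
    by (auto simp: partition_on_def card_ge_0_finite)
  also have "\<dots> = 2 * card M" using M(2) by simp
  finally show "card H = 2 * card M" .
qed

section \<open>Existence of a simple pairing\<close>

text \<open>A simple pairing of a largest possible part \<open>H'\<close> of \<open>H\<close> leaves nothing over. Otherwise at
  least two half-edges \<open>x\<close> and \<open>y\<close> are left over. If some pair is far from both, a switch
  matches \<open>x\<close> and \<open>y\<close> as well. If there is none, then only boundedly many pairs exist, hence so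
  many half-edges are left over that one of them can be paired with \<open>x\<close> directly.\<close>

lemma simple_pairings_nonempty:
  assumes fin: "finite H" and even: "even (card H)"
    and deg: "\<And>v. card {h \<in> H. fst h = v} \<le> D"
    and large: "card H > 6 * (D * (2 * D + 1))"
  shows "simple_pairings H \<noteq> {}"
proof -
  define c where "c = D * (2 * D + 1)"
  define P where "P m \<longleftrightarrow> (\<exists>H' M. H' \<subseteq> H \<and> M \<in> simple_pairings H' \<and> card H' = m)" for m
  have "{} \<in> simple_pairings {}"
    by (simp add: simple_pairings_def pairings_def partition_on_def)
  hence "P 0" unfolding P_def by (intro exI[of _ "{}"]) auto
  moreover have "\<forall>m. P m \<longrightarrow> m \<le> card H"
    unfolding P_def using fin by (auto intro: card_mono)
  ultimately obtain m where m: "P m" "\<And>m'. P m' \<Longrightarrow> m' \<le> m"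
    using Nat.ex_has_greatest_nat[of P 0 "card H"] by blast
  then obtain H' M where M: "H' \<subseteq> H" "M \<in> simple_pairings H'" "card H' = m"
    unfolding P_def by auto
  have finH': "finite H'" using M fin finite_subset by auto
  have M': "M \<in> pairings H'" using M(2) by (simp add: simple_pairings_def)
  have no_ext: "N \<notin> simple_pairings (insert x (insert y H'))"
    if "x \<in> H - H'" "y \<in> H - H'" "x \<noteq> y" for x y N
  proof
    assume "N \<in> simple_pairings (insert x (insert y H'))"
    moreover have "card (insert x (insert y H')) = m + 2"
      using that M finH' by simp
    ultimately have "P (m + 2)"
      unfolding P_def using that M(1) by (intro exI[of _ "insert x (insert y H')"]) auto
    from m(2)[OF this] show False by simp
  qed
  have "H' = H"
  proof (rule ccontr)
    assume "H' \<noteq> H"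
    have cardD: "card (H - H') = card H - card H'" using M(1) finH' card_Diff_subset by blast
    have "card H' < card H" using \<open>H' \<noteq> H\<close> M(1) fin by (simp add: psubset_card_mono psubsetI)
    moreover have "even (card H')" using card_pairing(2)[OF M' finH'] by simp
    ultimately have "card (H - H') \<ge> 2" using even cardD by presburger
    then obtain p where "p \<subseteq> H - H'" "card p = 2" by (rule obtain_subset_with_card_n)
    then obtain x y where xy: "x \<in> H - H'" "y \<in> H - H'" "x \<noteq> y" by (auto simp: card_2_iff)
    define T where "T = {h \<in> H. fst h \<in> nbhd M (fst x) \<union> nbhd M (fst y)}"
    have T: "card T \<le> 2 * c" "finite T"
      using card_over_two_nbhds_le[OF M(2,1) fin deg] fin by (auto simp: T_def c_def)
    show False
    proof (cases "\<exists>e\<in>M. e \<inter> T = {}")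
      case True
      then obtain e where e: "e \<in> M" "e \<inter> T = {}" by auto
      obtain u v where uv: "e = {u, v}" "u \<noteq> v"
        using M' e by (auto simp: pairings_def card_2_iff)
      have "u \<in> H" "v \<in> H"
        using M' M(1) e uv by (auto simp: pairings_def partition_on_def)
      thus False
        using no_ext[OF xy] simple_pairings_switch[OF M(2), of x y u v] xy e uv by (auto simp: T_def)
    next
      case False
      hence "{e \<in> M. e \<inter> T \<noteq> {}} = M" by auto
      hence "card M \<le> 2 * c"
        using card_hitting_le(2)[of M T] M' T by (auto simp: pairings_def partition_on_def)
      hence "card (H - H') > 2 * c"
        using large cardD card_pairing(2)[OF M' finH'] by (simp add: c_def)
      hence "card (H - H') > card {h \<in> H. fst h \<in> nbhd M (fst x)}"
        using card_over_nbhd_le[OF M(2,1) fin deg, of "fst x"] by (simp add: c_def)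
      hence "\<not> H - H' \<subseteq> {h \<in> H. fst h \<in> nbhd M (fst x)}"
        using fin card_mono[of "{h \<in> H. fst h \<in> nbhd M (fst x)}" "H - H'"] by auto
      then obtain z where z: "z \<in> H - H'" "fst z \<notin> nbhd M (fst x)" by auto
      hence "x \<noteq> z" by (auto simp: nbhd_def)
      thus False
        using no_ext[OF xy(1) z(1)] simple_pairings_add[OF M(2), of x z] xy z by auto
    qed
  qed
  with M show ?thesis by auto
qed

section \<open>The probability that a random simple pairing contains given pairs\<close>

text \<open>Double counting of switchings from pairings that contain \<open>insert a A\<close> to pairings that
  contain \<open>A\<close>: each of the former has at least \<open>K\<close> switchings, and each of the latter arises at
  most once.\<close>

lemma switching_count:
  assumes fin: "finite H" and deg: "\<And>v. card {h \<in> H. fst h = v} \<le> D"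
    and A: "finite A" "a \<notin> A"
    and large: "2 * (K + card A + 1 + 2 * (D * (2 * D + 1))) \<le> card H"
  shows "card {M \<in> simple_pairings H. insert a A \<subseteq> M} * K \<le> card {M \<in> simple_pairings H. A \<subseteq> M}"
proof (cases "{M \<in> simple_pairings H. insert a A \<subseteq> M} = {}")
  case True
  thus ?thesis by (simp only: True) simp
next
  case False
  define X where "X = {M \<in> simple_pairings H. insert a A \<subseteq> M}"
  define Y where "Y = {M \<in> simple_pairings H. A \<subseteq> M}"
  define c where "c = D * (2 * D + 1)"
  have finSP: "finite (simple_pairings H)"
    using finite_simple_pairings[OF fin] .
  note SP = simple_pairingsD(1-4)
  obtain x y where xy: "a = {x, y}" "x \<noteq> y" "x \<in> H" "y \<in> H"
  proof -
    from False obtain M where M: "M \<in> simple_pairings H" "a \<in> M" by auto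
    then obtain x y where "a = {x, y}" "x \<noteq> y" using SP(4) by (metis card_2_iff)
    with M SP(3)[OF M(1)] show ?thesis using that by blast
  qed
  obtain f g :: "('a \<times> 'b) set \<Rightarrow> 'a \<times> 'b"
    where fg: "\<And>e. card e = 2 \<Longrightarrow> e = {f e, g e} \<and> f e \<noteq> g e"
    by (metis card_2_iff)
  \<comment> \<open>The admissible pairs for a switch avoid \<open>T M\<close>. Neighbourhoods are taken in \<open>M - {a}\<close>, the
      partial pairing to which \<open>x\<close> and \<open>y\<close> are added back.\<close>
  define T where "T M = {h \<in> H. fst h \<in> nbhd (M - {a}) (fst x) \<union> nbhd (M - {a}) (fst y)}" for M
  define F where "F M = {e \<in> M - insert a A. e \<inter> T M = {}}" for M
  define sw where "sw = (\<lambda>(M, e). insert {x, f e} (insert {y, g e} (M - {a} - {e})))"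
  have X: "M \<in> simple_pairings H" "a \<in> M" "A \<subseteq> M" if "M \<in> X" for M
    using that by (auto simp: X_def)
  have rm: "M - {a} \<in> simple_pairings (H - a)" if "M \<in> X" for M
    using simple_pairings_remove X that by blast
  have F: "e \<in> M - {a}" "e = {f e, g e}" "f e \<noteq> g e" "f e \<in> H - a" "g e \<in> H - a" "e \<notin> A"
    "f e \<notin> T M" "g e \<notin> T M"
    if "M \<in> X" "e \<in> F M" for M e
  proof -
    show e: "e \<in> M - {a}" "e \<notin> A" using that by (auto simp: F_def)
    show fge: "e = {f e, g e}" "f e \<noteq> g e" using fg[of e] SP(4)[OF X(1)[OF that(1)]] e by auto
    have "e \<subseteq> H - a" using rm[OF that(1)] e by (auto simp: simple_pairings_def pairings_def partition_on_def)
    thus "f e \<in> H - a" "g e \<in> H - a" using fge by auto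
    have "e \<inter> T M = {}" using that by (auto simp: F_def)
    thus "f e \<notin> T M" "g e \<notin> T M" using fge by auto
  qed
  have cardF: "K \<le> card (F M)" if "M \<in> X" for M
  proof -
    note M = X[OF that]
    have finM: "finite M" and cM: "card H = 2 * card M" using card_pairing SP(1) M(1) fin by blast+
    have T: "card (T M) \<le> 2 * c" "finite (T M)"
      using card_over_two_nbhds_le[OF rm[OF that] _ fin deg] fin by (auto simp: T_def c_def)
    have "M \<subseteq> F M \<union> insert a A \<union> {e \<in> M. e \<inter> T M \<noteq> {}}" by (auto simp: F_def)
    hence "card M \<le> card (F M \<union> insert a A \<union> {e \<in> M. e \<inter> T M \<noteq> {}})"
      using finM A by (intro card_mono) (auto simp: F_def)
    also have "\<dots> \<le> card (F M) + card (insert a A) + card {e \<in> M. e \<inter> T M \<noteq> {}}"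
      by (meson add_le_mono1 card_Un_le le_trans)
    also have "card (insert a A) = card A + 1" using A by simp
    also have "card {e \<in> M. e \<inter> T M \<noteq> {}} \<le> 2 * c"
      using card_hitting_le(2)[OF SP(2)[OF M(1)] T(2)] T(1) by simp
    finally show ?thesis using large cM by (simp add: c_def)
  qed
  have swY: "sw (M, e) \<in> Y" if "M \<in> X" "e \<in> F M" for M e
  proof -
    note Fe = F[OF that]
    have "insert x (insert y (H - a)) = H" using xy by auto
    moreover have "sw (M, e) \<in> simple_pairings (insert x (insert y (H - a)))"
      unfolding sw_def prod.case
      using simple_pairings_switch[OF rm[OF that(1)], of x y "f e" "g e"] Fe xy by (auto simp: T_def)
    ultimately show ?thesis
      using X[OF that(1)] A Fe(1,6) by (auto simp: Y_def sw_def)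
  qed
  \<comment> \<open>The inverse of a switch reads off \<open>{u, v}\<close> as the current partners of \<open>x\<close> and \<open>y\<close>.\<close>
  define unsw where "unsw M' = (let P = {p \<in> M'. x \<in> p \<or> y \<in> p}; e = \<Union>P - {x, y}
     in (insert a (insert e (M' - P)), e))" for M'
  have unsw: "unsw (sw (M, e)) = (M, e)" if "M \<in> X" "e \<in> F M" for M e
  proof -
    note Fe = F[OF that]
    have no: "x \<notin> p" "y \<notin> p" if "p \<in> M - {a} - {e}" for p
      using that rm[OF \<open>M \<in> X\<close>] xy by (auto simp: simple_pairings_def pairings_def partition_on_def)
    have P: "{p \<in> sw (M, e). x \<in> p \<or> y \<in> p} = {{x, f e}, {y, g e}}"
      using no by (auto simp: sw_def)
    have "\<Union>{{x, f e}, {y, g e}} - {x, y} = {f e, g e}"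
      using Fe(4,5) xy by auto
    hence e: "\<Union>{{x, f e}, {y, g e}} - {x, y} = e"
      using Fe(2) by metis
    have "{x, f e} \<notin> M - {a} - {e}" "{y, g e} \<notin> M - {a} - {e}"
      using no by blast+
    hence "sw (M, e) - {{x, f e}, {y, g e}} = M - {a} - {e}"
      unfolding sw_def prod.case by blast
    moreover have "insert a (insert e (M - {a} - {e})) = M" using X(2)[OF that(1)] Fe(1) by auto
    ultimately show ?thesis unfolding unsw_def Let_def P e by simp
  qed
  have "card X * K = (\<Sum>M\<in>X. K)" by simp
  also have "\<dots> \<le> (\<Sum>M\<in>X. card (F M))" by (rule sum_mono) (rule cardF)
  also have "\<dots> = card (Sigma X F)"
  proof -
    have "finite X" using finSP by (simp add: X_def)
    moreover have "finite (F M)" if "M \<in> X" for M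
      using card_pairing(1)[OF SP(1)[OF X(1)[OF that]] fin] by (simp add: F_def)
    ultimately show ?thesis by (simp add: card_SigmaI)
  qed
  also have "\<dots> \<le> card Y"
  proof (rule card_inj_on_le)
    show "inj_on sw (Sigma X F)" by (rule inj_on_inverseI[of _ unsw]) (auto simp: unsw)
    show "sw ` Sigma X F \<subseteq> Y" using swY by auto
    show "finite Y" using finSP by (simp add: Y_def)
  qed
  finally show ?thesis by (simp add: X_def Y_def)
qed

text \<open>Every pair that is added to \<open>A\<close> costs a factor \<open>K\<close>.\<close>

lemma card_simple_pairings_containing_le:
  assumes fin: "finite H" and deg: "\<And>v. card {h \<in> H. fst h = v} \<le> D"
    and "finite A" and "2 * (K + card A + 2 * (D * (2 * D + 1))) \<le> card H"
  shows "card {M \<in> simple_pairings H. A \<subseteq> M} * K ^ card A \<le> card (simple_pairings H)"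
  using assms(3,4)
proof (induction A)
  case (insert a A)
  have "card {M \<in> simple_pairings H. insert a A \<subseteq> M} * K ^ card (insert a A)
        = (card {M \<in> simple_pairings H. insert a A \<subseteq> M} * K) * K ^ card A"
    using insert.hyps by simp
  also have "\<dots> \<le> card {M \<in> simple_pairings H. A \<subseteq> M} * K ^ card A"
    using switching_count[OF fin deg insert.hyps, of K] insert.prems insert.hyps
    by (intro mult_le_mono1) simp
  also have "\<dots> \<le> card (simple_pairings H)"
    using insert.IH insert.prems insert.hyps by simp
  finally show ?case .
qed simp

section \<open>The simple random graph as a uniformly random simple pairing\<close>

lemma simple_multigraph_of_pairing_iff:
  assumes "M \<in> pairings H" "finite H"
  shows "simple (multigraph_of_pairing M) \<longleftrightarrow> M \<in> simple_pairings H"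
proof -
  have fin: "finite M" using card_pairing(1)[OF assms] .
  have count: "count (multigraph_of_pairing M) E = card {e \<in> M. fst ` e = E}" for E
  proof -
    have "count (multigraph_of_pairing M) E = card ((`) fst -` {E} \<inter> M)"
      using fin by (simp add: multigraph_of_pairing_def count_image_mset)
    also have "(`) fst -` {E} \<inter> M = {e \<in> M. fst ` e = E}" by auto
    finally show ?thesis .
  qed
  have "inj_on ((`) fst) M \<longleftrightarrow> (\<forall>e\<in>M. card {e' \<in> M. fst ` e' = fst ` e} = 1)"
  proof
    assume inj: "inj_on ((`) fst) M"
    have "{e' \<in> M. fst ` e' = fst ` e} = {e}" if "e \<in> M" for e
      using inj that by (auto dest: inj_onD)
    thus "\<forall>e\<in>M. card {e' \<in> M. fst ` e' = fst ` e} = 1" by simp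
  next
    assume *: "\<forall>e\<in>M. card {e' \<in> M. fst ` e' = fst ` e} = 1"
    show "inj_on ((`) fst) M"
    proof (rule inj_onI)
      fix e e' assume e: "e \<in> M" "e' \<in> M" "fst ` e = fst ` e'"
      obtain z where z: "{e' \<in> M. fst ` e' = fst ` e} = {z}"
        using * e(1) by (meson card_1_singletonE)
      have "e \<in> {z}" "e' \<in> {z}" unfolding z[symmetric] using e by simp_all
      thus "e = e'" by simp
    qed
  qed
  moreover have "set_mset (multigraph_of_pairing M) = (`) fst ` M"
    using fin by (simp add: multigraph_of_pairing_def)
  ultimately show ?thesis
    using assms(1) by (auto simp: simple_def simple_pairings_def count)
qed

text \<open>A uniform distribution conditioned on an event is uniform on that event, so that
  probabilities become ratios of numbers of simple pairings.\<close>

lemma prob_simple_configuration_model: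
  assumes ne: "simple_pairings (half_edges n d) \<noteq> {}"
  shows "measure_pmf.prob (simple_configuration_model n d) B =
    card {M \<in> simple_pairings (half_edges n d). multigraph_of_pairing M \<in> B}
      / card (simple_pairings (half_edges n d))"
proof -
  define H where "H = half_edges n d"
  have finP: "finite (pairings H)" by (simp add: H_def finite_pairings finite_half_edges)
  have sub: "simple_pairings H \<subseteq> pairings H" by (auto simp: simple_pairings_def)
  have neP: "pairings H \<noteq> {}" using ne sub unfolding H_def by blast
  have finS: "finite (simple_pairings H)" using finP sub finite_subset by blast
  have eq: "pairings H \<inter> multigraph_of_pairing -` {G. simple G} = simple_pairings H"
    using simple_multigraph_of_pairing_iff[of _ H] sub finite_half_edges unfolding H_def by blast
  have ne': "set_pmf (pmf_of_set (pairings H)) \<inter> multigraph_of_pairing -` {G. simple G} \<noteq> {}"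
    using eq ne neP finP by (simp add: H_def)
  have "cond_pmf (pmf_of_set (pairings H)) (multigraph_of_pairing -` {G. simple G})
        = pmf_of_set (simple_pairings H)"
  proof (rule pmf_eqI)
    fix M
    show "pmf (cond_pmf (pmf_of_set (pairings H)) (multigraph_of_pairing -` {G. simple G})) M
        = pmf (pmf_of_set (simple_pairings H)) M"
      using neP finP finS ne eq
      by (subst pmf_cond[OF ne']) (auto simp: measure_pmf_of_set H_def indicator_def)
  qed
  hence "simple_configuration_model n d
         = map_pmf multigraph_of_pairing (pmf_of_set (simple_pairings H))"
    unfolding simple_configuration_model_def pairing_model_def H_def[symmetric]
    by (simp add: cond_map_pmf[OF ne'])
  moreover have "simple_pairings H \<inter> multigraph_of_pairing -` B
                 = {M \<in> simple_pairings H. multigraph_of_pairing M \<in> B}" by auto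
  ultimately show ?thesis
    using finS ne by (simp add: measure_pmf_of_set H_def)
qed

lemma edges_within_multigraph_of_pairing:
  assumes "finite M"
  shows "edges_within (multigraph_of_pairing M) S = card {e \<in> M. fst ` e \<subseteq> S}"
  using assms by (simp add: edges_within_def multigraph_of_pairing_def filter_mset_image_mset)

section \<open>The union bound\<close>

text \<open>The left-hand side divided by \<open>fact k\<close> is one term of the series of \<open>exp k\<close>, and
  \<open>exp 1 \<le> 3\<close>.\<close>

lemma power_self_le_fact: "real k ^ k \<le> 3 ^ k * fact k"
proof -
  have "(\<lambda>n. real k ^ n /\<^sub>R fact n) sums exp (real k)" by (rule exp_converges)
  hence "(\<Sum>n\<in>{k}. real k ^ n /\<^sub>R fact n) \<le> exp (real k)"
    using sum_le_suminf[of "\<lambda>n. real k ^ n /\<^sub>R fact n" "{k}"] by (simp add: sums_iff)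
  also have "exp (real k) = exp 1 ^ k" by (simp add: exp_of_nat_mult[symmetric])
  also have "\<dots> \<le> 3 ^ k" by (intro power_mono exp_le) auto
  finally show ?thesis by (simp add: field_simps)
qed

lemma binomial_le_power:
  assumes "k > 0"
  shows "real (N choose k) \<le> (3 * real N / real k) ^ k"
proof -
  have "real (N choose k) * real k ^ k \<le> real (N choose k) * (3 ^ k * fact k)"
    by (intro mult_left_mono power_self_le_fact) auto
  also have "\<dots> = 3 ^ k * real ((N choose k) * fact k)" by simp
  also have "\<dots> \<le> 3 ^ k * real (N ^ k)"
    by (intro mult_left_mono of_nat_mono binomial_fact_pow) auto
  finally show ?thesis using assms by (simp add: field_simps power_mult_distrib power_divide)
qed

text \<open>If at least \<open>k\<close> edges lie within \<open>S\<close>, then the pairing contains some set of \<open>k\<close> pairs of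
  half-edges at \<open>S\<close>. There are at most \<open>(D |S|)\<^sup>2\<close> such pairs, so by \<open>|S| \<le> k\<close> there are at most
  \<open>(3 D\<^sup>2 |S|\<^sup>2 / k)\<^sup>k \<le> (3 D\<^sup>2 |S|)\<^sup>k\<close> sets, each contained in the pairing with probability
  at most \<open>1 / K\<^sup>k\<close>.\<close>

lemma card_dense_simple_pairings_le:
  assumes fin: "finite H" and deg: "\<And>v. card {h \<in> H. fst h = v} \<le> D" and S: "finite S"
    and k: "k > 0" "card S \<le> k" and K: "K > 0"
    and large: "2 * (K + k + 2 * (D * (2 * D + 1))) \<le> card H"
  shows "real (card {M \<in> simple_pairings H. k \<le> card {e \<in> M. fst ` e \<subseteq> S}})
    \<le> (3 * real D ^ 2 * real (card S) / real K) ^ k * real (card (simple_pairings H))"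
proof -
  define T where "T = {h \<in> H. fst h \<in> S}"
  define Q where "Q = {e. e \<subseteq> T \<and> card e = 2}"
  define \<A> where "\<A> = {A. A \<subseteq> Q \<and> card A = k}"
  let ?SP = "simple_pairings H"
  have finSP: "finite ?SP"
    using finite_simple_pairings[OF fin] .
  have finT: "finite T" using fin by (simp add: T_def)
  have finQ: "finite Q" using finT by (simp add: Q_def)
  have finA: "finite \<A>" using finQ by (simp add: \<A>_def)
  have "card T \<le> D * card S"
    unfolding T_def by (rule card_half_edges_over_le[OF fin S deg])
  hence "card T ^ 2 \<le> (D * card S) ^ 2" by (rule power_mono) simp
  hence cardQ: "card Q \<le> (D * card S) ^ 2"
    using n_subsets[OF finT, of 2] binomial_fact_pow[of "card T" 2]
    unfolding Q_def fact_2 by linarith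
  have "{M \<in> ?SP. k \<le> card {e \<in> M. fst ` e \<subseteq> S}} \<subseteq> (\<Union>A\<in>\<A>. {M \<in> ?SP. A \<subseteq> M})"
  proof
    fix M assume "M \<in> {M \<in> ?SP. k \<le> card {e \<in> M. fst ` e \<subseteq> S}}"
    hence M: "M \<in> ?SP" "k \<le> card {e \<in> M. fst ` e \<subseteq> S}" by auto
    then obtain A where A: "A \<subseteq> {e \<in> M. fst ` e \<subseteq> S}" "card A = k"
      by (meson obtain_subset_with_card_n)
    have "A \<subseteq> Q"
      using A(1) simple_pairingsD(3,4)[OF M(1)] by (fastforce simp: Q_def T_def)
    thus "M \<in> (\<Union>A\<in>\<A>. {M \<in> ?SP. A \<subseteq> M})" using A M by (auto simp: \<A>_def)
  qed
  hence "card {M \<in> ?SP. k \<le> card {e \<in> M. fst ` e \<subseteq> S}} \<le> card (\<Union>A\<in>\<A>. {M \<in> ?SP. A \<subseteq> M})"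
    using finA finSP by (intro card_mono) auto
  also have "\<dots> \<le> (\<Sum>A\<in>\<A>. card {M \<in> ?SP. A \<subseteq> M})"
    by (rule card_UN_le[OF finA])
  finally have "real (card {M \<in> ?SP. k \<le> card {e \<in> M. fst ` e \<subseteq> S}})
      \<le> real (\<Sum>A\<in>\<A>. card {M \<in> ?SP. A \<subseteq> M})"
    by (rule of_nat_mono)
  also have "\<dots> = (\<Sum>A\<in>\<A>. real (card {M \<in> ?SP. A \<subseteq> M}))" by (rule of_nat_sum)
  also have "\<dots> \<le> (\<Sum>A\<in>\<A>. real (card ?SP) / real K ^ k)"
  proof (rule sum_mono)
    fix A assume "A \<in> \<A>"
    hence A: "finite A" "card A = k" using finite_subset[OF _ finQ] by (simp_all add: \<A>_def)
    have "card {M \<in> ?SP. A \<subseteq> M} * K ^ k \<le> card ?SP"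
      using card_simple_pairings_containing_le[OF fin deg A(1), of K] large A(2) by simp
    hence "real (card {M \<in> ?SP. A \<subseteq> M}) * real K ^ k \<le> real (card ?SP)"
      unfolding of_nat_mult[symmetric] of_nat_power[symmetric] by (rule of_nat_mono)
    thus "real (card {M \<in> ?SP. A \<subseteq> M}) \<le> real (card ?SP) / real K ^ k"
      using K by (simp add: field_simps)
  qed
  also have "\<dots> = real (card Q choose k) * (real (card ?SP) / real K ^ k)"
    using n_subsets[OF finQ, of k] by (simp add: \<A>_def)
  also have "\<dots> \<le> (3 * real D ^ 2 * real (card S)) ^ k * (real (card ?SP) / real K ^ k)"
  proof (rule mult_right_mono)
    have "real (card Q) \<le> (real D * real (card S)) ^ 2"
      using cardQ unfolding of_nat_mult[symmetric] of_nat_power[symmetric] by (rule of_nat_mono)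
    also have "\<dots> = real D ^ 2 * real (card S) * real (card S)"
      by (simp add: power2_eq_square)
    also have "\<dots> \<le> real D ^ 2 * real (card S) * real k"
      using k by (intro mult_left_mono) auto
    finally have "3 * real (card Q) / real k \<le> 3 * real D ^ 2 * real (card S)"
      using k by (simp add: field_simps)
    hence "(3 * real (card Q) / real k) ^ k \<le> (3 * real D ^ 2 * real (card S)) ^ k"
      by (rule power_mono) simp
    with binomial_le_power[OF k(1), of "card Q"]
    show "real (card Q choose k) \<le> (3 * real D ^ 2 * real (card S)) ^ k" by linarith
  qed simp
  finally show ?thesis
    by (simp add: power_divide)
qed

lemma summable_powr_half: "summable (\<lambda>s. real s powr \<epsilon> * (1/2) ^ s)"
proof (rule summable_comparison_test_bigo)
  show "summable (\<lambda>s. norm ((3/4 :: real) ^ s))" by (simp add: summable_geometric)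
  show "(\<lambda>s. real s powr \<epsilon> * (1/2) ^ s) \<in> O(\<lambda>s. (3/4) ^ s)" by real_asymp
qed

text \<open>The choice \<open>K = n div 4\<close> is at least \<open>n / 8\<close>, so the base of the \<open>k\<close>-th power is at most
  \<open>24 D\<^sup>2 s / n \<le> 1\<close>, and \<open>k\<close> can be lowered to \<open>(1 + \<epsilon>) s\<close>. Together with the at most
  \<open>(3 n / s)\<^sup>s\<close> sets of \<open>s\<close> vertices this leaves \<open>s / n\<close> with the exponent \<open>\<epsilon>\<close> in the base of an
  \<open>s\<close>-th power.\<close>

lemma union_bound_term_le:
  fixes n s k D :: nat and \<epsilon> :: real
  assumes n: "n \<ge> 4" and s: "s > 0" and D: "D > 0"
    and small: "24 * real D ^ 2 * (real s / real n) \<le> 1"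
    and k: "(1 + \<epsilon>) * real s \<le> real k"
  shows "real (n choose s) * (3 * real D ^ 2 * real s / real (n div 4)) ^ k
    \<le> (3 * (24 * real D ^ 2) powr (1 + \<epsilon>) * (real s / real n) powr \<epsilon>) ^ s"
proof -
  define y where "y = real s / real n"
  define x where "x = 24 * real D ^ 2 * y"
  have y: "y > 0" using n s by (simp add: y_def)
  have x: "0 < x" "x \<le> 1" using y D small by (simp_all add: x_def) (simp add: y_def)
  have "n \<le> 8 * (n div 4)" "n div 4 > 0" using n by presburger+
  hence K: "real n \<le> 8 * real (n div 4)" "real (n div 4) > 0" by linarith+
  have "3 * real D ^ 2 * real s / real (n div 4) \<le> x"
  proof -
    have "3 * real D ^ 2 * real s * real n \<le> 3 * real D ^ 2 * real s * (8 * real (n div 4))"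
      using K by (intro mult_left_mono) auto
    thus ?thesis using K n by (simp add: x_def y_def field_simps)
  qed
  hence "(3 * real D ^ 2 * real s / real (n div 4)) ^ k \<le> x ^ k"
    by (intro power_mono) auto
  also have "x ^ k = x powr real k" using x by (simp add: powr_realpow)
  also have "\<dots> \<le> x powr ((1 + \<epsilon>) * real s)" using x k by (intro powr_mono') auto
  also have "\<dots> = (x powr (1 + \<epsilon>)) ^ s"
    using x by (simp add: powr_powr[symmetric] powr_realpow)
  finally have 1: "(3 * real D ^ 2 * real s / real (n div 4)) ^ k \<le> (x powr (1 + \<epsilon>)) ^ s" .
  have "real (n choose s) \<le> (3 / y) ^ s"
    using binomial_le_power[OF s, of n] by (simp add: y_def)
  hence "real (n choose s) * (3 * real D ^ 2 * real s / real (n div 4)) ^ k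
         \<le> (3 / y) ^ s * (x powr (1 + \<epsilon>)) ^ s"
    using 1 y by (intro mult_mono) auto
  also have "\<dots> = (3 / y * x powr (1 + \<epsilon>)) ^ s" by (rule power_mult_distrib[symmetric])
  also have "x powr (1 + \<epsilon>) = (24 * real D ^ 2) powr (1 + \<epsilon>) * (y * y powr \<epsilon>)"
    using y D by (simp add: x_def powr_mult powr_add)
  also have "3 / y * \<dots> = 3 * (24 * real D ^ 2) powr (1 + \<epsilon>) * y powr \<epsilon>"
    using y by simp
  finally show ?thesis unfolding y_def .
qed

text \<open>The first condition on \<open>\<eta>\<close> makes the term bound applicable, the second one makes the terms
  decay geometrically in \<open>s\<close>, and the third one, with the lower bounds on \<open>n\<close>, keeps the
  number of prescribed pairs small enough for the switchings.\<close>

lemma card_bad_simple_pairings_le: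
  fixes n D :: nat and \<epsilon> \<eta> C :: real
  defines "C \<equiv> 3 * (24 * real D ^ 2) powr (1 + \<epsilon>)"
  assumes fin: "finite H" and deg: "\<And>v. card {h \<in> H. fst h = v} \<le> D" and D: "D > 0"
    and H: "card H \<ge> n" and n: "n \<ge> 4" "n \<ge> 16 * (D * (2 * D + 1))"
    and \<epsilon>: "\<epsilon> > 0" and \<eta>: "24 * real D ^ 2 * \<eta> \<le> 1" "C * \<eta> powr \<epsilon> \<le> 1/2" "8 * (2 + \<epsilon>) * \<eta> \<le> 1"
  shows "real (card {M \<in> simple_pairings H. \<exists>S\<subseteq>{1..n}. real (card S) \<le> \<eta> * real n \<and>
           (1 + \<epsilon>) * real (card S) < real (card {e \<in> M. fst ` e \<subseteq> S})})
    \<le> 2 * C * (\<Sum>s. real s powr \<epsilon> * (1/2) ^ s) * real n powr (-\<epsilon>) * real (card (simple_pairings H))"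
    (is "real (card ?Bad) \<le> _")
proof -
  let ?SP = "simple_pairings H"
  define I where "I = {s. 0 < s \<and> real s \<le> \<eta> * real n}"
  define k where "k s = nat \<lceil>(1 + \<epsilon>) * real s\<rceil>" for s
  define B where "B S = {M \<in> ?SP. k (card S) \<le> card {e \<in> M. fst ` e \<subseteq> S}}" for S
  define q where "q s = (C * (real s / real n) powr \<epsilon>) ^ s" for s
  have finSP: "finite ?SP"
    using finite_simple_pairings[OF fin] .
  have finB: "finite (B S)" for S using finSP by (simp add: B_def)
  have finI: "finite I"
    by (rule finite_subset[of _ "{..nat \<lceil>\<eta> * real n\<rceil>}"]) (auto simp: I_def le_nat_iff, linarith)
  have fin_sets: "finite {S. S \<subseteq> {1..n} \<and> card S = s}" for s by simp
  have C: "C > 0" using D by (simp add: C_def)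
  have "?Bad \<subseteq> (\<Union>s\<in>I. \<Union>S\<in>{S. S \<subseteq> {1..n} \<and> card S = s}. B S)"
  proof
    fix M assume "M \<in> ?Bad"
    then obtain S where M: "M \<in> ?SP" and S: "S \<subseteq> {1..n}" "real (card S) \<le> \<eta> * real n"
      and dense: "(1 + \<epsilon>) * real (card S) < real (card {e \<in> M. fst ` e \<subseteq> S})" by auto
    have "card S \<noteq> 0"
    proof
      assume "card S = 0"
      hence "S = {}" using S(1) finite_subset by fastforce
      moreover have "{} \<notin> M" using simple_pairingsD(4)[OF M, of "{}"] by auto
      ultimately have "{e \<in> M. fst ` e \<subseteq> S} = {}" by auto
      thus False using dense \<open>card S = 0\<close> by (simp only: card.empty of_nat_0 mult_zero_right)
    qed
    moreover have "k (card S) \<le> card {e \<in> M. fst ` e \<subseteq> S}"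
      using dense unfolding k_def by linarith
    ultimately show "M \<in> (\<Union>s\<in>I. \<Union>S\<in>{S. S \<subseteq> {1..n} \<and> card S = s}. B S)"
      using M S by (auto simp: I_def B_def)
  qed
  hence "card ?Bad \<le> card (\<Union>s\<in>I. \<Union>S\<in>{S. S \<subseteq> {1..n} \<and> card S = s}. B S)"
    using finI finB by (intro card_mono) auto
  also have "\<dots> \<le> (\<Sum>s\<in>I. card (\<Union>S\<in>{S. S \<subseteq> {1..n} \<and> card S = s}. B S))"
    by (rule card_UN_le[OF finI])
  also have "\<dots> \<le> (\<Sum>s\<in>I. \<Sum>S\<in>{S. S \<subseteq> {1..n} \<and> card S = s}. card (B S))"
    by (intro sum_mono card_UN_le[OF fin_sets])
  finally have "real (card ?Bad)
      \<le> real (\<Sum>s\<in>I. \<Sum>S\<in>{S. S \<subseteq> {1..n} \<and> card S = s}. card (B S))"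
    by (rule of_nat_mono)
  also have "\<dots> = (\<Sum>s\<in>I. \<Sum>S\<in>{S. S \<subseteq> {1..n} \<and> card S = s}. real (card (B S)))"
    by (simp only: of_nat_sum)
  also have "\<dots> \<le> (\<Sum>s\<in>I. q s * real (card ?SP))"
  proof (rule sum_mono)
    fix s assume "s \<in> I"
    hence s: "s > 0" "real s \<le> \<eta> * real n" by (auto simp: I_def)
    have sn: "real s / real n \<le> \<eta>" using s n by (simp add: field_simps)
    have "0 \<le> (1 + \<epsilon>) * real s" using \<epsilon> by simp
    hence k: "(1 + \<epsilon>) * real s \<le> real (k s)" "real (k s) \<le> (1 + \<epsilon>) * real s + 1"
      unfolding k_def by linarith+
    have "real s \<le> (1 + \<epsilon>) * real s" using \<epsilon> by (simp add: algebra_simps)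
    hence ks: "s \<le> k s" using k(1) by linarith
    have "real (k s) \<le> (1 + \<epsilon>) * real s + real s"
      using k(2) s(1) by linarith
    hence "8 * real (k s) \<le> 8 * (2 + \<epsilon>) * real s" by (simp add: algebra_simps)
    also have "\<dots> \<le> 8 * (2 + \<epsilon>) * (\<eta> * real n)"
      using s \<epsilon> by (intro mult_left_mono) auto
    also have "\<dots> = 8 * (2 + \<epsilon>) * \<eta> * real n" by simp
    also have "\<dots> \<le> 1 * real n" by (intro mult_right_mono \<eta>) auto
    finally have "8 * k s \<le> n" by linarith
    moreover have "4 * (n div 4) \<le> n" by simp
    ultimately have large: "2 * (n div 4 + k s + 2 * (D * (2 * D + 1))) \<le> card H"
      using n(2) H unfolding distrib_left[of 2] by linarith
    define b where "b = (3 * real D ^ 2 * real s / real (n div 4)) ^ k s"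
    have "(\<Sum>S\<in>{S. S \<subseteq> {1..n} \<and> card S = s}. real (card (B S)))
          \<le> (\<Sum>S\<in>{S. S \<subseteq> {1..n} \<and> card S = s}. b * real (card ?SP))"
    proof (rule sum_mono)
      fix S assume "S \<in> {S. S \<subseteq> {1..n} \<and> card S = s}"
      hence S: "finite S" "card S = s" using finite_subset[of S "{1..n}"] by simp_all
      show "real (card (B S)) \<le> b * real (card ?SP)"
        using card_dense_simple_pairings_le[OF fin deg S(1) _ _ _ large] s ks S(2) n
        by (simp add: B_def b_def)
    qed
    also have "\<dots> = real (n choose s) * b * real (card ?SP)"
      using n_subsets[of "{1..n}" s] by simp
    also have "real (n choose s) * b \<le> q s"
      unfolding b_def q_def C_def
    proof (rule union_bound_term_le)
      have "24 * real D ^ 2 * (real s / real n) \<le> 24 * real D ^ 2 * \<eta>"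
        using sn by (intro mult_left_mono) auto
      thus "24 * real D ^ 2 * (real s / real n) \<le> 1" using \<eta>(1) by linarith
    qed (use n s D k in auto)
    finally show "(\<Sum>S\<in>{S. S \<subseteq> {1..n} \<and> card S = s}. real (card (B S))) \<le> q s * real (card ?SP)"
      by (simp add: mult_right_mono)
  qed
  also have "\<dots> = (\<Sum>s\<in>I. q s) * real (card ?SP)" by (simp add: sum_distrib_right)
  also have "(\<Sum>s\<in>I. q s) \<le> (\<Sum>s\<in>I. 2 * C * real n powr (-\<epsilon>) * (real s powr \<epsilon> * (1/2) ^ s))"
  proof (rule sum_mono)
    fix s assume "s \<in> I"
    hence s: "s > 0" "real s \<le> \<eta> * real n" by (auto simp: I_def)
    define z where "z = C * (real s / real n) powr \<epsilon>"
    have "real s / real n \<le> \<eta>" using s n by (simp add: field_simps)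
    hence "z \<le> C * \<eta> powr \<epsilon>"
      unfolding z_def using \<epsilon> C by (intro mult_left_mono powr_mono2) auto
    hence z: "z \<le> 1/2" using \<eta>(2) by (rule order_trans)
    have z0: "0 \<le> z" using C by (simp add: z_def)
    \<comment> \<open>One factor \<open>z\<close> is kept: it carries the decay in \<open>n\<close>. The others are at most \<open>1/2\<close>.\<close>
    have "q s = z * z ^ (s - 1)"
      using s by (simp add: q_def z_def power_eq_if)
    also have "\<dots> \<le> z * (1/2) ^ (s - 1)"
      using z z0 by (intro mult_left_mono power_mono) auto
    also have "\<dots> = 2 * z * (1/2) ^ s" using s by (simp add: power_eq_if)
    also have "\<dots> = 2 * C * real n powr (-\<epsilon>) * (real s powr \<epsilon> * (1/2) ^ s)"
      by (simp add: z_def powr_divide powr_minus field_simps)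
    finally show "q s \<le> 2 * C * real n powr (-\<epsilon>) * (real s powr \<epsilon> * (1/2) ^ s)" .
  qed
  also have "\<dots> = 2 * C * real n powr (-\<epsilon>) * (\<Sum>s\<in>I. real s powr \<epsilon> * (1/2) ^ s)"
    by (simp add: sum_distrib_left)
  also have "\<dots> \<le> 2 * C * real n powr (-\<epsilon>) * (\<Sum>s. real s powr \<epsilon> * (1/2) ^ s)"
    using C finI by (intro mult_left_mono sum_le_suminf summable_powr_half) auto
  finally show ?thesis by (simp add: mult_right_mono mult_ac)
qed

section \<open>Small vertex sets are sparse\<close>

theorem corollary4p3:
  fixes \<Delta> :: nat and \<epsilon> :: real
  assumes "\<epsilon> > 0"
  shows "\<exists>\<eta>::real. \<eta> > 0 \<and>
    (\<forall>d :: nat \<Rightarrow> nat \<Rightarrow> nat.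
      (\<forall>n. even (\<Sum>i=1..n. d n i)) \<longrightarrow>
      (\<forall>n. \<forall>i\<in>{1..n}. 1 \<le> d n i \<and> d n i \<le> \<Delta>) \<longrightarrow>
      (\<lambda>n. measure_pmf.prob (simple_configuration_model n (d n))
         {G. \<forall>S \<subseteq> {1..n}. real (card S) \<le> \<eta> * real n \<longrightarrow>
               real (edges_within G S) \<le> (1 + \<epsilon>) * real (card S)})
        \<longlonglongrightarrow> 1)"
proof -
  \<comment> \<open>The maximum keeps \<open>\<eta>\<close> positive for \<open>\<Delta> = 0\<close>, as \<open>1 / 0 = 0\<close>.\<close>
  define D where "D = max 1 \<Delta>"
  define c where "c = D * (2 * D + 1)"
  define C where "C = 3 * (24 * real D ^ 2) powr (1 + \<epsilon>)"
  define W where "W = (\<Sum>s. real s powr \<epsilon> * (1/2) ^ s)"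
  define \<eta> where "\<eta> = Min {1 / (24 * real D ^ 2), (1 / (2 * C)) powr (1 / \<epsilon>), 1 / (8 * (2 + \<epsilon>))}"
  have D: "D > 0" "\<Delta> \<le> D" by (auto simp: D_def)
  have C: "C > 0" using D by (simp add: C_def)
  have \<eta>: "\<eta> > 0" using D C assms by (simp add: \<eta>_def)
  have \<eta>1: "24 * real D ^ 2 * \<eta> \<le> 1"
  proof -
    have "\<eta> \<le> 1 / (24 * real D ^ 2)" by (simp add: \<eta>_def)
    thus ?thesis using D by (simp add: field_simps)
  qed
  have \<eta>2: "C * \<eta> powr \<epsilon> \<le> 1/2"
  proof -
    have "\<eta> \<le> (1 / (2 * C)) powr (1 / \<epsilon>)" by (simp add: \<eta>_def)
    hence "\<eta> powr \<epsilon> \<le> ((1 / (2 * C)) powr (1 / \<epsilon>)) powr \<epsilon>"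
      using \<eta> assms by (intro powr_mono2) auto
    also have "\<dots> = 1 / (2 * C)" using assms C by (simp add: powr_powr)
    finally show ?thesis using C by (simp add: field_simps)
  qed
  have \<eta>3: "8 * (2 + \<epsilon>) * \<eta> \<le> 1"
  proof -
    have "\<eta> \<le> 1 / (8 * (2 + \<epsilon>))" by (simp add: \<eta>_def)
    thus ?thesis using assms by (simp add: field_simps)
  qed
  have "(\<lambda>n. measure_pmf.prob (simple_configuration_model n (d n))
         {G. \<forall>S \<subseteq> {1..n}. real (card S) \<le> \<eta> * real n \<longrightarrow>
               real (edges_within G S) \<le> (1 + \<epsilon>) * real (card S)}) \<longlonglongrightarrow> 1"
    if even: "\<And>n. even (\<Sum>i=1..n. d n i)"
      and bounds: "\<And>n i. i \<in> {1..n} \<Longrightarrow> 1 \<le> d n i \<and> d n i \<le> \<Delta>"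
    for d :: "nat \<Rightarrow> nat \<Rightarrow> nat"
  proof -
    define good where "good n = {G. \<forall>S \<subseteq> {1..n}. real (card S) \<le> \<eta> * real n \<longrightarrow>
               real (edges_within G S) \<le> (1 + \<epsilon>) * real (card S)}" for n
    define p where "p n = measure_pmf.prob (simple_configuration_model n (d n)) (good n)" for n
    have lower: "1 - 2 * C * W * real n powr (-\<epsilon>) \<le> p n" if n: "n \<ge> 16 * c" "n \<ge> 4" for n
    proof -
      define H where "H = half_edges n (d n)"
      let ?SP = "simple_pairings H"
      have finH: "finite H" by (simp add: H_def finite_half_edges)
      have cardH: "card H = (\<Sum>i=1..n. d n i)" by (simp add: H_def card_half_edges)
      have deg: "card {h \<in> H. fst h = v} \<le> D" for v
      proof (cases "v \<in> {1..n}")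
        case True
        hence "{h \<in> H. fst h = v} = {v} \<times> {..<d n v}" by (auto simp: H_def half_edges_def)
        thus ?thesis using bounds[OF True] D by simp
      next
        case False
        hence "{h \<in> H. fst h = v} = {}" by (auto simp: H_def half_edges_def)
        thus ?thesis by (simp only: card.empty)
      qed
      have "(\<Sum>i=1..n. 1) \<le> (\<Sum>i=1..n. d n i)" by (rule sum_mono) (use bounds in auto)
      hence Hn: "n \<le> card H" by (simp add: cardH)
      have "c > 0" using D by (simp add: c_def)
      hence "card H > 6 * c" using Hn n by linarith
      hence ne: "?SP \<noteq> {}"
        using simple_pairings_nonempty[OF finH _ deg] even cardH by (simp add: c_def)
      have "finite ?SP"
        using finite_simple_pairings[OF finH] .
      hence pos: "card ?SP > 0" using ne by (simp add: card_gt_0_iff)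
      define Bad where "Bad = {M \<in> ?SP. \<exists>S\<subseteq>{1..n}. real (card S) \<le> \<eta> * real n \<and>
           (1 + \<epsilon>) * real (card S) < real (card {e \<in> M. fst ` e \<subseteq> S})}"
      have "{M \<in> ?SP. multigraph_of_pairing M \<in> - good n} = Bad"
      proof -
        have "edges_within (multigraph_of_pairing M) S = card {e \<in> M. fst ` e \<subseteq> S}"
          if "M \<in> ?SP" for M S
          by (rule edges_within_multigraph_of_pairing[OF card_pairing(1)[OF simple_pairingsD(1)[OF that] finH]])
        thus ?thesis unfolding Bad_def good_def by (simp add: not_le cong: conj_cong)
      qed
      moreover have "measure_pmf.prob (simple_configuration_model n (d n)) (- good n)
          = card {M \<in> ?SP. multigraph_of_pairing M \<in> - good n} / card ?SP"
        unfolding H_def by (rule prob_simple_configuration_model) (use ne in \<open>simp add: H_def\<close>)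
      moreover have "measure_pmf.prob (simple_configuration_model n (d n)) (- good n) = 1 - p n"
        using measure_pmf.prob_compl[of "good n"] by (simp add: p_def Compl_eq_Diff_UNIV)
      ultimately have "1 - p n = card Bad / card ?SP" by simp
      moreover have "real (card Bad) \<le> 2 * C * W * real n powr (-\<epsilon>) * real (card ?SP)"
        unfolding Bad_def C_def W_def
        by (rule card_bad_simple_pairings_le[OF finH deg D(1) Hn n(2) n(1)[unfolded c_def] assms
              \<eta>1 \<eta>2[unfolded C_def] \<eta>3])
      ultimately have "1 - p n \<le> 2 * C * W * real n powr (-\<epsilon>)"
        using pos by (simp only: pos_divide_le_eq of_nat_0_less_iff)
      thus ?thesis by linarith
    qed
    have "p \<longlonglongrightarrow> 1"
    proof (rule tendsto_sandwich)
      show "eventually (\<lambda>n. 1 - 2 * C * W * real n powr (-\<epsilon>) \<le> p n) sequentially"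
        using eventually_ge_at_top[of "16 * c"] eventually_ge_at_top[of 4]
        by eventually_elim (rule lower)
      show "eventually (\<lambda>n. p n \<le> 1) sequentially"
        by (simp add: p_def)
      show "(\<lambda>n. 1 - 2 * C * W * real n powr (-\<epsilon>)) \<longlonglongrightarrow> 1"
        using assms by real_asymp
    qed auto
    thus ?thesis unfolding p_def[abs_def] good_def .
  qed
  thus ?thesis using \<eta> by blast
qed

end
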